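(* Let $G=(V,E)$ be a connected undirected graph with nodes $v_1,\dots,v_M$, $M\ge 2$, let $N_i$ be the neighbor set of $v_i$, $\Delta=\max_i|N_i|$, and let $\varepsilon\in(0,\frac{1}{\Delta+1}]$. Let $x_1[0],\dots,x_M[0]\in\mathbb{R}$, and let $x_i^{\alpha}[0],x_i^{\beta}[0]\in\mathbb{R}$ be any numbers with $x_i^{\alpha}[0]+x_i^{\beta}[0]=2x_i[0]$ for every $i$. Let the sub-states evolve, for $k=0,1,2,\dots$ and $i=1,\dots,M$, by $$x_i^{\alpha}[k+1]=x_i^{\alpha}[k]+\varepsilon\sum_{v_j\in N_i}a_{ij}[k]\,(x_j^{\alpha}[k]-x_i^{\alpha}[k])+\varepsilon\,a_{i,\alpha\beta}[k]\,(x_i^{\beta}[k]-x_i^{\alpha}[k]),$$ $$x_i^{\beta}[k+1]=x_i^{\beta}[k]+\varepsilon\,a_{i,\alpha\beta}[k]\,(x_i^{\alpha}[k]-x_i^{\beta}[k]),$$ where the coupling weights obey the Weight Mechanism (defined in the context). Then for every $i=1,\dots,M$, $$\lim_{k\to\infty}x_i^{\alpha}[k]=\lim_{k\to\infty}x_i^{\beta}[k]=\frac1M\sum_{j=1}^M x_j[0].$$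
   Context: The graph is fixed (independent of time), without self-loops, and $N_i=\{v_j:(v_i,v_j)\in E\}$. The weights are real numbers $a_{ij}[k]$ (for $(v_i,v_j)\in E$) and $a_{i,\alpha\beta}[k]$ (for each node $i$), with $a_{ij}[k]=a_{ji}[k]$ for all $k\ge 0$; weights $a_{ij}[k]$ for non-edges are $0$. Weight Mechanism: at $k=0$, the weights $a_{ij}[0]=a_{ji}[0]$ on edges and the weights $a_{i,\alpha\beta}[0]$ are arbitrary real numbers. There is a scalar $0<\eta<1$ such that for all $k\ge 1$, $\eta\le a_{ij}[k]<1$ for every edge $(v_i,v_j)\in E$, and $\eta\le a_{i,\alpha\beta}[k]<1$ for every $i$. *)

theory Defs
  imports Complex_Main
begin

text \<open>
  An undirected edge is represented by both of its orientations, so that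
  \<open>neighbors E i\<close> is the set of all \<open>j\<close> joined to \<open>i\<close>.
\<close>

definition undirected_graph :: "nat set \<Rightarrow> (nat \<times> nat) set \<Rightarrow> bool" where
  "undirected_graph V E \<longleftrightarrow> finite V \<and> E \<subseteq> V \<times> V \<and> sym E \<and> irrefl E"

definition connected_graph :: "nat set \<Rightarrow> (nat \<times> nat) set \<Rightarrow> bool" where
  "connected_graph V E \<longleftrightarrow>
     undirected_graph V E \<and> V \<noteq> {} \<and> (\<forall>i\<in>V. \<forall>j\<in>V. (i, j) \<in> E\<^sup>*)"

definition neighbors :: "(nat \<times> nat) set \<Rightarrow> nat \<Rightarrow> nat set" where
  "neighbors E i = {j. (i, j) \<in> E}"

definition max_degree :: "nat set \<Rightarrow> (nat \<times> nat) set \<Rightarrow> nat" where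
  "max_degree V E = Max ((\<lambda>i. card (neighbors E i)) ` V)"

text \<open>
  \<open>a i j k\<close> is the weight of the edge \<open>(i, j)\<close> at time \<open>k\<close>, and \<open>c i k\<close> is the
  weight coupling the two sub-states of node \<open>i\<close>. The bounds start at time 1:
  apart from symmetry, the weights at time 0 are arbitrary reals. The bound \<open>\<eta>\<close> is
  uniform in time and over all nodes and edges.
\<close>

definition weight_mechanism ::
    "nat set \<Rightarrow> (nat \<times> nat) set \<Rightarrow> (nat \<Rightarrow> nat \<Rightarrow> nat \<Rightarrow> real) \<Rightarrow> (nat \<Rightarrow> nat \<Rightarrow> real) \<Rightarrow> bool" where
  "weight_mechanism V E a c \<longleftrightarrow>
     (\<forall>k. \<forall>i\<in>V. \<forall>j\<in>V. a i j k = a j i k) \<and>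
     (\<forall>k. \<forall>i\<in>V. \<forall>j\<in>V. (i, j) \<notin> E \<longrightarrow> a i j k = 0) \<and>
     (\<exists>\<eta>. 0 < \<eta> \<and> \<eta> < 1 \<and>
        (\<forall>k\<ge>1. (\<forall>(i, j)\<in>E. \<eta> \<le> a i j k \<and> a i j k < 1) \<and>
               (\<forall>i\<in>V. \<eta> \<le> c i k \<and> c i k < 1)))"

end

theory Submission
  imports Defs
begin

text \<open>
  The two sub-states of all nodes form one vector that is multiplied at each step by a symmetric
  matrix with row sums 1, whose entries are nonnegative from time 1 on. From then on the sum of
  squares of this vector decreases, and the decrease
  is the sum over all rows of the variance of the vector with respect to the row. This is summable
  in time, so every row variance tends to 0, and with it the difference of any two entries whose
  weights in a common row are bounded away from 0. The diagonal entries of the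
  \<open>\<alpha>\<close>-states admit no such bound; but row \<open>\<beta>\<^sub>i\<close> couples \<open>\<alpha>\<^sub>i\<close> with
  \<open>\<beta>\<^sub>i\<close>, whose diagonal entry is at least 1/2, and row \<open>\<alpha>\<^sub>i\<close> couples \<open>\<beta>\<^sub>i\<close>
  with \<open>\<alpha>\<^sub>j\<close> for every neighbor \<open>j\<close>. By connectedness all differences tend to 0, and
  conservation of the total sum identifies the limit.
\<close>

section \<open>Variance decay under time-varying doubly stochastic matrices\<close>

text \<open>The right-hand side is the variance of \<open>y\<close> under the weights
  \<open>p\<close>, a sum of nonnegative terms. The terms at \<open>u\<close> and \<open>v\<close>
  alone give the bound, by Cauchy-Schwarz for two terms and \<open>p u + p v <= 1\<close>.\<close>

lemma weighted_variance_ge: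
  fixes p y :: "'a \<Rightarrow> real"
  assumes fin: "finite U" and nn: "\<And>u. u \<in> U \<Longrightarrow> 0 \<le> p u" and one: "sum p U = 1"
    and uv: "u \<in> U" "v \<in> U" "u \<noteq> v"
  shows "p u * p v * (y u - y v)\<^sup>2 \<le> (\<Sum>w\<in>U. p w * (y w)\<^sup>2) - (\<Sum>w\<in>U. p w * y w)\<^sup>2"
proof -
  define m where "m = (\<Sum>w\<in>U. p w * y w)"
  have "(\<Sum>w\<in>U. p w * (y w - m)\<^sup>2) =
      (\<Sum>w\<in>U. p w * (y w)\<^sup>2 - 2 * m * (p w * y w) + m\<^sup>2 * p w)"
    by (intro sum.cong) (auto simp: power2_eq_square algebra_simps)
  also have "\<dots> = (\<Sum>w\<in>U. p w * (y w)\<^sup>2) - 2 * m * (\<Sum>w\<in>U. p w * y w) + m\<^sup>2 * sum p U"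
    by (simp add: sum.distrib sum_subtractf sum_distrib_left)
  also have "\<dots> = (\<Sum>w\<in>U. p w * (y w)\<^sup>2) - m\<^sup>2"
    unfolding one m_def[symmetric] by (simp add: power2_eq_square)
  finally have var: "(\<Sum>w\<in>U. p w * (y w - m)\<^sup>2) = (\<Sum>w\<in>U. p w * (y w)\<^sup>2) - m\<^sup>2" .
  define s t where "s = y u - m" and "t = y v - m"
  have le1: "p u + p v \<le> 1"
    using sum_mono2[OF fin, of "{u, v}" p] uv nn one by auto
  have nn2: "0 \<le> p u * s\<^sup>2 + p v * t\<^sup>2"
    using nn uv by simp
  \<comment> \<open>Lagrange's identity, the exact defect in the two-term Cauchy-Schwarz
    inequality.\<close>
  have "(p u + p v) * (p u * s\<^sup>2 + p v * t\<^sup>2) - p u * p v * (s - t)\<^sup>2 = (p u * s + p v * t)\<^sup>2"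
    by (simp add: power2_eq_square algebra_simps)
  then have "p u * p v * (s - t)\<^sup>2 \<le> (p u + p v) * (p u * s\<^sup>2 + p v * t\<^sup>2)"
    by (metis diff_ge_0_iff_ge zero_le_power2)
  also have "\<dots> \<le> p u * s\<^sup>2 + p v * t\<^sup>2"
    using mult_right_mono[OF le1 nn2] by simp
  also have "\<dots> = (\<Sum>w\<in>{u, v}. p w * (y w - m)\<^sup>2)"
    using uv by (simp add: s_def t_def)
  also have "\<dots> \<le> (\<Sum>w\<in>U. p w * (y w - m)\<^sup>2)"
    using fin uv nn by (intro sum_mono2) auto
  finally show ?thesis
    unfolding var by (simp add: s_def t_def m_def)
qed

lemma decreasing_nonneg_diff_tendsto_0:
  fixes S :: "nat \<Rightarrow> real"
  assumes "\<And>k. S (Suc k) \<le> S k" and "\<And>k. 0 \<le> S k"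
  shows "(\<lambda>k. S k - S (Suc k)) \<longlonglongrightarrow> 0"
proof -
  have "decseq S"
    using assms(1) by (simp add: decseq_Suc_iff)
  then obtain L where L: "S \<longlonglongrightarrow> L"
    using assms(2) decseq_convergent[of S 0] by blast
  from tendsto_diff[OF L LIMSEQ_Suc[OF L]] show ?thesis
    by simp
qed

text \<open>Only the row \<open>w\<close> is asked for a uniform lower bound: all row variances are
  nonnegative, so that of row \<open>w\<close> is at most the decrease of the sum of squares, which
  tends to 0.\<close>

lemma doubly_stochastic_diff_tendsto_0:
  fixes W :: "nat \<Rightarrow> 'a \<Rightarrow> 'a \<Rightarrow> real" and x :: "nat \<Rightarrow> 'a \<Rightarrow> real"
  assumes fin: "finite U"
    and nn: "\<And>k w u. w \<in> U \<Longrightarrow> u \<in> U \<Longrightarrow> 0 \<le> W k w u"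
    and row: "\<And>k w. w \<in> U \<Longrightarrow> (\<Sum>u\<in>U. W k w u) = 1"
    and col: "\<And>k u. u \<in> U \<Longrightarrow> (\<Sum>w\<in>U. W k w u) = 1"
    and step: "\<And>k w. w \<in> U \<Longrightarrow> x (Suc k) w = (\<Sum>u\<in>U. W k w u * x k u)"
    and mem: "w \<in> U" "u \<in> U" "v \<in> U" "u \<noteq> v"
    and \<delta>: "0 < \<delta>" "\<And>k. \<delta> \<le> W k w u * W k w v"
  shows "(\<lambda>k. x k u - x k v) \<longlonglongrightarrow> 0"
proof -
  define S where "S k = (\<Sum>w\<in>U. (x k w)\<^sup>2)" for k
  define D where "D k w = (\<Sum>u\<in>U. W k w u * (x k u)\<^sup>2) - (x (Suc k) w)\<^sup>2" for k w
  have Dge: "W k w' u' * W k w' v' * (x k u' - x k v')\<^sup>2 \<le> D k w'"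
    if "w' \<in> U" "u' \<in> U" "v' \<in> U" "u' \<noteq> v'" for k w' u' v'
    unfolding D_def step[OF that(1)] using that fin nn row
    by (intro weighted_variance_ge) auto
  have Dnn: "0 \<le> D k w'" if "w' \<in> U" for k w'
  proof -
    have "0 \<le> W k w' u * W k w' v * (x k u - x k v)\<^sup>2"
      using nn that mem by simp
    also have "\<dots> \<le> D k w'"
      using Dge that mem by blast
    finally show ?thesis .
  qed
  have SD: "S k - S (Suc k) = (\<Sum>w\<in>U. D k w)" for k
  proof -
    \<comment> \<open>Here the column sums enter: added over all rows, the weighted means of the
      squares give back \<open>S k\<close>.\<close>
    have "(\<Sum>w\<in>U. \<Sum>u\<in>U. W k w u * (x k u)\<^sup>2) = (\<Sum>u\<in>U. \<Sum>w\<in>U. W k w u * (x k u)\<^sup>2)"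
      by (rule sum.swap)
    also have "\<dots> = S k"
      by (simp add: S_def col flip: sum_distrib_right)
    finally show ?thesis
      by (simp add: D_def S_def sum_subtractf)
  qed
  have bound: "(x k u - x k v)\<^sup>2 \<le> (S k - S (Suc k)) / \<delta>" for k
  proof -
    have "\<delta> * (x k u - x k v)\<^sup>2 \<le> W k w u * W k w v * (x k u - x k v)\<^sup>2"
      using \<delta>(2) by (intro mult_right_mono) auto
    also have "\<dots> \<le> D k w"
      using Dge mem by blast
    also have "\<dots> \<le> (\<Sum>w\<in>U. D k w)"
      using fin mem Dnn by (intro member_le_sum) auto
    finally show ?thesis
      using \<delta>(1) by (simp add: SD field_simps)
  qed
  have "0 \<le> S k - S (Suc k)" for k
    unfolding SD by (simp add: Dnn sum_nonneg)
  then have "(\<lambda>k. S k - S (Suc k)) \<longlonglongrightarrow> 0"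
    by (intro decreasing_nonneg_diff_tendsto_0) (auto simp: S_def sum_nonneg)
  then have "(\<lambda>k. (S k - S (Suc k)) / \<delta>) \<longlonglongrightarrow> 0"
    using tendsto_divide_zero by blast
  then have "(\<lambda>k. (x k u - x k v)\<^sup>2) \<longlonglongrightarrow> 0"
    by (rule tendsto_sandwich[OF _ _ tendsto_const, rotated 2]) (auto simp: bound)
  then show ?thesis
    by simp
qed

lemma column_stochastic_sum_const:
  fixes x :: "nat \<Rightarrow> 'a \<Rightarrow> real"
  assumes col: "\<And>k u. u \<in> U \<Longrightarrow> (\<Sum>w\<in>U. W k w u) = 1"
    and step: "\<And>k w. w \<in> U \<Longrightarrow> x (Suc k) w = (\<Sum>u\<in>U. W k w u * x k u)"
  shows "(\<Sum>w\<in>U. x k w) = (\<Sum>w\<in>U. x 0 w)"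
proof (induction k)
  case (Suc k)
  have "(\<Sum>w\<in>U. x (Suc k) w) = (\<Sum>w\<in>U. \<Sum>u\<in>U. W k w u * x k u)"
    by (simp add: step)
  also have "\<dots> = (\<Sum>u\<in>U. \<Sum>w\<in>U. W k w u * x k u)"
    by (rule sum.swap)
  also have "\<dots> = (\<Sum>u\<in>U. x k u)"
    by (simp add: col flip: sum_distrib_right)
  finally show ?case
    using Suc by simp
qed simp

lemma tendsto_mean_of_diffs:
  fixes x :: "nat \<Rightarrow> 'a \<Rightarrow> real"
  assumes fin: "finite U" and u: "u \<in> U"
    and diff: "\<And>v. v \<in> U \<Longrightarrow> (\<lambda>k. x k u - x k v) \<longlonglongrightarrow> 0"
    and total: "\<And>k. (\<Sum>v\<in>U. x k v) = T"
  shows "(\<lambda>k. x k u) \<longlonglongrightarrow> T / real (card U)"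
proof -
  have pos: "real (card U) > 0"
    using fin u card_gt_0_iff by auto
  \<comment> \<open>This sequence is \<open>x k u\<close> itself, written through the differences
    and the constant total.\<close>
  have "(\<lambda>k. ((\<Sum>v\<in>U. x k u - x k v) + T) / real (card U))
      \<longlonglongrightarrow> ((\<Sum>v\<in>U. 0) + T) / real (card U)"
    using pos by (intro tendsto_intros diff) auto
  moreover have "((\<Sum>v\<in>U. x k u - x k v) + T) / real (card U) = x k u" for k
    using pos by (simp add: sum_subtractf total)
  ultimately show ?thesis
    by simp
qed

lemma tendsto_diff_0_rtrancl:
  fixes x :: "nat \<Rightarrow> 'a \<Rightarrow> real"
  assumes "(u, v) \<in> R\<^sup>*"
    and "\<And>u v. (u, v) \<in> R \<Longrightarrow> (\<lambda>k. x k u - x k v) \<longlonglongrightarrow> 0"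
  shows "(\<lambda>k. x k u - x k v) \<longlonglongrightarrow> 0"
  using assms(1)
proof (induction rule: rtrancl_induct)
  case (step v w)
  from tendsto_add[OF step.IH assms(2)[OF step.hyps(2)]] show ?case
    by simp
qed simp

section \<open>The update matrix of the sub-states\<close>

text \<open>\<open>Inl i\<close> and \<open>Inr i\<close> index the sub-states \<open>\<alpha>\<close> and \<open>\<beta>\<close> of node \<open>i\<close>.\<close>

fun substate_matrix ::
    "'a set \<Rightarrow> real \<Rightarrow> ('a \<Rightarrow> 'a \<Rightarrow> real) \<Rightarrow> ('a \<Rightarrow> real) \<Rightarrow> 'a + 'a \<Rightarrow> 'a + 'a \<Rightarrow> real" where
  "substate_matrix V e a c (Inl i) (Inl j) =
     e * a i j + (if j = i then 1 - e * (sum (a i) V + c i) else 0)"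
| "substate_matrix V e a c (Inl i) (Inr j) = (if j = i then e * c i else 0)"
| "substate_matrix V e a c (Inr i) (Inl j) = (if j = i then e * c i else 0)"
| "substate_matrix V e a c (Inr i) (Inr j) = (if j = i then 1 - e * c i else 0)"

lemma substate_matrix_sym:
  assumes "\<And>i j. i \<in> V \<Longrightarrow> j \<in> V \<Longrightarrow> a i j = a j i" and "u \<in> V <+> V" and "v \<in> V <+> V"
  shows "substate_matrix V e a c u v = substate_matrix V e a c v u"
  using assms by (cases u; cases v) auto

lemma substate_matrix_apply:
  assumes "finite V" and "i \<in> V"
  shows "(\<Sum>u\<in>V <+> V. substate_matrix V e a c (Inl i) u * x u) =
      x (Inl i) + e * (\<Sum>j\<in>V. a i j * (x (Inl j) - x (Inl i))) + e * c i * (x (Inr i) - x (Inl i))"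
    and "(\<Sum>u\<in>V <+> V. substate_matrix V e a c (Inr i) u * x u) =
      x (Inr i) + e * c i * (x (Inl i) - x (Inr i))"
proof -
  have delta: "(\<Sum>j\<in>V. (if j = i then b else 0) * f j) = b * f i" for b :: real and f
  proof -
    have "(\<Sum>j\<in>V. (if j = i then b else 0) * f j) = (\<Sum>j\<in>V. if j = i then b * f j else 0)"
      by (intro sum.cong) auto
    then show ?thesis
      using assms by simp
  qed
  show "(\<Sum>u\<in>V <+> V. substate_matrix V e a c (Inl i) u * x u) =
      x (Inl i) + e * (\<Sum>j\<in>V. a i j * (x (Inl j) - x (Inl i))) + e * c i * (x (Inr i) - x (Inl i))"
    using assms
    by (simp add: sum.Plus distrib_right sum.distrib delta right_diff_distrib sum_subtractf
        mult.assoc flip: sum_distrib_left sum_distrib_right)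
      (simp add: algebra_simps)
  show "(\<Sum>u\<in>V <+> V. substate_matrix V e a c (Inr i) u * x u) =
      x (Inr i) + e * c i * (x (Inl i) - x (Inr i))"
    using assms by (simp add: sum.Plus delta) (simp add: algebra_simps)
qed

text \<open>The update leaves a constant vector unchanged, because every correction is a multiple of
  a difference of entries.\<close>

lemma substate_matrix_row_sum:
  assumes "finite V" and "w \<in> V <+> V"
  shows "(\<Sum>u\<in>V <+> V. substate_matrix V e a c w u) = 1"
  using assms substate_matrix_apply[of V _ e a c "\<lambda>_. 1"] by auto

lemma substate_matrix_col_sum:
  assumes "finite V" and "\<And>i j. i \<in> V \<Longrightarrow> j \<in> V \<Longrightarrow> a i j = a j i" and "u \<in> V <+> V"
  shows "(\<Sum>w\<in>V <+> V. substate_matrix V e a c w u) = 1"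
proof -
  have "(\<Sum>w\<in>V <+> V. substate_matrix V e a c w u) = (\<Sum>w\<in>V <+> V. substate_matrix V e a c u w)"
    using assms by (intro sum.cong substate_matrix_sym) auto
  then show ?thesis
    using substate_matrix_row_sum assms by metis
qed

text \<open>Only the diagonal needs care. The bound on \<open>e * (sum (a i) V + c i)\<close>
  settles the \<alpha> rows; dropping the nonnegative edge weights from it settles the \<beta>
  rows.\<close>

lemma substate_matrix_nonneg:
  assumes "0 \<le> e" and "\<And>i j. i \<in> V \<Longrightarrow> j \<in> V \<Longrightarrow> 0 \<le> a i j" and "\<And>i. i \<in> V \<Longrightarrow> 0 \<le> c i"
    and "\<And>i. i \<in> V \<Longrightarrow> e * (sum (a i) V + c i) \<le> 1"
    and "u \<in> V <+> V" and "v \<in> V <+> V"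
  shows "0 \<le> substate_matrix V e a c u v"
proof -
  have "e * c i \<le> 1" if "i \<in> V" for i
  proof -
    have "e * c i \<le> e * (sum (a i) V + c i)"
      using assms(1,2) that by (intro mult_left_mono) (auto simp: sum_nonneg)
    then show ?thesis
      using assms(4)[OF that] by linarith
  qed
  then show ?thesis
    using assms by (cases u; cases v) auto
qed

section \<open>Degree bound and convergence to the average\<close>

text \<open>A path from \<open>i\<close> to a different node must leave \<open>i\<close> along an
  edge. This serves to bound the step size by 1/2.\<close>

lemma connected_graph_degree_pos:
  assumes "connected_graph V E" and "i \<in> V" and "j \<in> V" and "i \<noteq> j"
  shows "0 < card (neighbors E i)"
proof -
  have "(i, j) \<in> E\<^sup>*" "finite V" "E \<subseteq> V \<times> V"
    using assms by (auto simp: connected_graph_def undirected_graph_def)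
  then obtain l where "(i, l) \<in> E"
    using \<open>i \<noteq> j\<close> by (metis converse_rtranclE)
  moreover have "finite (neighbors E i)"
    using \<open>finite V\<close> \<open>E \<subseteq> V \<times> V\<close> by (auto simp: neighbors_def intro: finite_subset)
  ultimately show ?thesis
    by (auto simp: neighbors_def card_gt_0_iff)
qed

theorem theorem1:
  fixes M :: nat
    and E :: "(nat \<times> nat) set"
    and \<epsilon> :: real
    and a :: "nat \<Rightarrow> nat \<Rightarrow> nat \<Rightarrow> real"
    and c :: "nat \<Rightarrow> nat \<Rightarrow> real"
    and x0 :: "nat \<Rightarrow> real"
    and x\<alpha> x\<beta> :: "nat \<Rightarrow> nat \<Rightarrow> real"
  assumes "M \<ge> 2"
    and "connected_graph {1..M} E"
    and "0 < \<epsilon>" and "\<epsilon> \<le> 1 / (real (max_degree {1..M} E) + 1)"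
    and "weight_mechanism {1..M} E a c"
    and "\<And>i. i \<in> {1..M} \<Longrightarrow> x\<alpha> i 0 + x\<beta> i 0 = 2 * x0 i"
    and "\<And>i k. i \<in> {1..M} \<Longrightarrow>
           x\<alpha> i (Suc k) = x\<alpha> i k + \<epsilon> * (\<Sum>j\<in>neighbors E i. a i j k * (x\<alpha> j k - x\<alpha> i k))
                          + \<epsilon> * c i k * (x\<beta> i k - x\<alpha> i k)"
    and "\<And>i k. i \<in> {1..M} \<Longrightarrow>
           x\<beta> i (Suc k) = x\<beta> i k + \<epsilon> * c i k * (x\<alpha> i k - x\<beta> i k)"
  shows "\<forall>i\<in>{1..M}. (\<lambda>k. x\<alpha> i k) \<longlonglongrightarrow> (\<Sum>j = 1..M. x0 j) / real M \<and>
                      (\<lambda>k. x\<beta> i k) \<longlonglongrightarrow> (\<Sum>j = 1..M. x0 j) / real M"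
proof -
  define V where "V = {1..M}"
  define U where "U = V <+> V"
  define W where "W k = substate_matrix V \<epsilon> (\<lambda>i j. a i j k) (\<lambda>i. c i k)" for k
  define x where "x k = case_sum (\<lambda>i. x\<alpha> i k) (\<lambda>i. x\<beta> i k)" for k
  have finV: "finite V" and finU: "finite U" and cardU: "card U = 2 * M"
    by (simp_all add: V_def U_def card_Plus)
  have graph: "E \<subseteq> V \<times> V" "sym E" "irrefl E" "\<And>i j. i \<in> V \<Longrightarrow> j \<in> V \<Longrightarrow> (i, j) \<in> E\<^sup>*"
    using assms(2) by (auto simp: connected_graph_def undirected_graph_def V_def)
  have nbV: "neighbors E i \<subseteq> V" for i
    using graph by (auto simp: neighbors_def)
  have asym: "a i j k = a j i k" and a0: "(i, j) \<notin> E \<Longrightarrow> a i j k = 0"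
    if "i \<in> V" "j \<in> V" for i j k
    using assms(5) that by (auto simp: weight_mechanism_def V_def)
  obtain \<eta> where \<eta>: "0 < \<eta>"
    and abd: "\<And>k i j. k \<ge> 1 \<Longrightarrow> (i, j) \<in> E \<Longrightarrow> \<eta> \<le> a i j k \<and> a i j k < 1"
    and cbd: "\<And>k i. k \<ge> 1 \<Longrightarrow> i \<in> V \<Longrightarrow> \<eta> \<le> c i k \<and> c i k < 1"
    using assms(5) unfolding weight_mechanism_def V_def by blast
  \<comment> \<open>Weights of non-edges vanish, so neighbor sums become sums over \<open>V\<close>,
    as the matrix form requires.\<close>
  have nbsum: "(\<Sum>j\<in>V. a i j k * f j) = (\<Sum>j\<in>neighbors E i. a i j k * f j)"
    if "i \<in> V" for i k f
    using finV nbV that by (intro sum.mono_neutral_right) (auto simp: neighbors_def a0)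
  have deg_le: "card (neighbors E i) \<le> max_degree V E" if "i \<in> V" for i
    using finV that by (simp add: max_degree_def)
  \<comment> \<open>Two distinct nodes exist since \<open>M >= 2\<close>; a maximal degree of at
    least 1 then turns the bound on \<epsilon> into 1/2.\<close>
  have "0 < card (neighbors E 1)"
    using assms(1,2) by (intro connected_graph_degree_pos[of "{1..M}" _ 1 2]) auto
  then have "1 \<le> max_degree V E"
    using deg_le[of 1] assms(1) by (auto simp: V_def)
  then have "1 / (real (max_degree V E) + 1) \<le> 1 / 2"
    by (intro divide_left_mono) auto
  then have half: "\<epsilon> \<le> 1 / 2"
    using assms(4) unfolding V_def by linarith
  \<comment> \<open>From time 1 on, each of the at most \<open>max_degree V E\<close> edge weights
    and the weight \<open>c i k\<close> are below 1, so the bracket is at most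
    \<open>max_degree V E + 1\<close>.\<close>
  have row_le: "\<epsilon> * ((\<Sum>j\<in>V. a i j k) + c i k) \<le> 1" if "i \<in> V" "k \<ge> 1" for i k
  proof -
    have "(\<Sum>j\<in>V. a i j k) = (\<Sum>j\<in>neighbors E i. a i j k)"
      using nbsum[OF that(1), of k "\<lambda>_. 1"] by simp
    also have "\<dots> \<le> (\<Sum>j\<in>neighbors E i. 1)"
      using abd that by (intro sum_mono) (auto simp: neighbors_def intro: less_imp_le)
    also have "\<dots> \<le> real (max_degree V E)"
      using deg_le that by simp
    finally have "\<epsilon> * ((\<Sum>j\<in>V. a i j k) + c i k) \<le> \<epsilon> * (real (max_degree V E) + 1)"
      using cbd[OF that(2,1)] assms(3) by (intro mult_left_mono) auto
    also have "\<dots> \<le> 1"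
      using assms(4) by (simp add: V_def field_simps)
    finally show ?thesis .
  qed
  have step: "x (Suc k) w = (\<Sum>u\<in>U. W k w u * x k u)" if "w \<in> U" for k w
    using that assms(7,8)[folded V_def]
    by (auto simp: U_def W_def substate_matrix_apply[OF finV] nbsum x_def)
  have row: "(\<Sum>u\<in>U. W k w u) = 1" if "w \<in> U" for k w
    using that finV unfolding U_def W_def by (intro substate_matrix_row_sum)
  have col: "(\<Sum>w\<in>U. W k w u) = 1" if "u \<in> U" for k u
    using that finV asym unfolding U_def W_def by (intro substate_matrix_col_sum)
  have a_nn: "0 \<le> a i j k" if "i \<in> V" "j \<in> V" "k \<ge> 1" for i j k
    using that a0 abd \<eta> by (cases "(i, j) \<in> E") force+
  have c_nn: "0 \<le> c i k" if "i \<in> V" "k \<ge> 1" for i k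
    using cbd[OF that(2,1)] \<eta> by simp
  have nn: "0 \<le> W (Suc k) w u" if "w \<in> U" "u \<in> U" for k w u
    using that assms(3) a_nn c_nn row_le unfolding U_def W_def
    by (intro substate_matrix_nonneg) auto

  \<comment> \<open>\<open>W 0\<close> may have negative entries, so the decay argument runs on the
    sequence shifted by one step, which has the same limit.\<close>
  have coupled: "(\<lambda>k. x k u - x k v) \<longlonglongrightarrow> 0"
    if "w \<in> U" "u \<in> U" "v \<in> U" "u \<noteq> v" "0 < \<delta>" "\<And>k. \<delta> \<le> W (Suc k) w u * W (Suc k) w v"
    for w u v \<delta>
  proof -
    have "(\<lambda>k. x (Suc k) u - x (Suc k) v) \<longlonglongrightarrow> 0"
      using that finU nn row col step
      by (intro doubly_stochastic_diff_tendsto_0[where W = "\<lambda>k. W (Suc k)" and U = U and w = w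
            and x = "\<lambda>k. x (Suc k)"])
    then show ?thesis
      by (rule LIMSEQ_imp_Suc)
  qed
  have \<epsilon>c: "\<epsilon> * \<eta> \<le> \<epsilon> * c i (Suc k)" "\<epsilon> * c i (Suc k) \<le> 1 / 2" if "i \<in> V" for i k
    using cbd[of "Suc k" i] that assms(3) half mult_mono[of \<epsilon> "1 / 2" "c i (Suc k)" 1] c_nn
    by auto
  have \<alpha>\<beta>: "(\<lambda>k. x k (Inl i) - x k (Inr i)) \<longlonglongrightarrow> 0" if i: "i \<in> V" for i
  \<comment> \<open>The factors bound the off-diagonal entry \<open>\<epsilon> * c i (Suc k)\<close>
    and the diagonal entry \<open>1 - \<epsilon> * c i (Suc k)\<close> from below.\<close>
  proof (rule coupled[of "Inr i" _ _ "\<epsilon> * \<eta> * (1 / 2)"])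
    show "\<epsilon> * \<eta> * (1 / 2) \<le> W (Suc k) (Inr i) (Inl i) * W (Suc k) (Inr i) (Inr i)" for k
      using \<epsilon>c[OF i, of k] assms(3) \<eta> unfolding W_def
      by (simp only: substate_matrix.simps) (intro mult_mono, auto)
  qed (use i assms(3) \<eta> in \<open>auto simp: U_def\<close>)
  have \<beta>\<alpha>: "(\<lambda>k. x k (Inr i) - x k (Inl j)) \<longlonglongrightarrow> 0" if ij: "(i, j) \<in> E" for i j
  proof (rule coupled[of "Inl i" _ _ "(\<epsilon> * \<eta>) * (\<epsilon> * \<eta>)"])
    \<comment> \<open>Irreflexivity makes \<open>Inl j\<close> an off-diagonal position in row
      \<open>Inl i\<close>, so its entry is just \<epsilon> times the edge weight.\<close>
    have iV: "i \<in> V" "j \<in> V" and "j \<noteq> i"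
      using ij graph by (auto simp: irrefl_def)
    then show "(\<epsilon> * \<eta>) * (\<epsilon> * \<eta>) \<le> W (Suc k) (Inl i) (Inr i) * W (Suc k) (Inl i) (Inl j)" for k
      using \<epsilon>c[of i k] assms(3) \<eta> abd[OF _ ij, of "Suc k"] unfolding W_def
      by (simp only: substate_matrix.simps) (intro mult_mono, auto)
    show "Inl i \<in> U" "Inr i \<in> U" "Inl j \<in> U"
      using iV by (auto simp: U_def)
  qed (use assms(3) \<eta> in auto)
  have \<alpha>\<alpha>: "(\<lambda>k. x k (Inl i) - x k (Inl j)) \<longlonglongrightarrow> 0" if "i \<in> V" "j \<in> V" for i j
  proof (rule tendsto_diff_0_rtrancl[where x = "\<lambda>k i. x k (Inl i)", OF graph(4)[OF that]])
    fix i j assume ij: "(i, j) \<in> E"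
    then have "i \<in> V"
      using graph by auto
    \<comment> \<open>An edge is crossed in two moves, from \<alpha> to \<beta> within node
      \<open>i\<close> and then to \<alpha> of node \<open>j\<close>.\<close>
    from tendsto_add[OF \<alpha>\<beta>[OF this] \<beta>\<alpha>[OF ij]]
    show "(\<lambda>k. x k (Inl i) - x k (Inl j)) \<longlonglongrightarrow> 0"
      by simp
  qed
  have all: "(\<lambda>k. x k u - x k v) \<longlonglongrightarrow> 0" if "u \<in> U" "v \<in> U" for u v
  proof -
    have to\<alpha>: "(\<lambda>k. x k w - x k (Inl 1)) \<longlonglongrightarrow> 0" if "w \<in> U" for w
    proof -
      have one: "1 \<in> V"
        using assms(1) by (simp add: V_def)
      from that consider i where "i \<in> V" "w = Inl i" | i where "i \<in> V" "w = Inr i"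
        by (auto simp: U_def)
      then show ?thesis
      proof cases
        case 1
        then show ?thesis
          using \<alpha>\<alpha> one by simp
      next
        case 2
        from tendsto_diff[OF \<alpha>\<alpha>[OF 2(1) one] \<alpha>\<beta>[OF 2(1)]] 2(2) show ?thesis
          by simp
      qed
    qed
    from tendsto_diff[OF to\<alpha>[OF that(1)] to\<alpha>[OF that(2)]] show ?thesis
      by simp
  qed
  \<comment> \<open>Column sums are 1 at time 0 as well, so the total survives the arbitrary first
    step. The factor 2 cancels against \<open>card U = 2 * M\<close>.\<close>
  have total: "(\<Sum>u\<in>U. x k u) = 2 * (\<Sum>j = 1..M. x0 j)" for k
  proof -
    have "(\<Sum>u\<in>U. x k u) = (\<Sum>u\<in>U. x 0 u)"
      using col step by (rule column_stochastic_sum_const)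
    also have "\<dots> = (\<Sum>i\<in>V. x\<alpha> i 0 + x\<beta> i 0)"
      by (simp add: U_def sum.Plus finV x_def sum.distrib)
    also have "\<dots> = 2 * (\<Sum>j = 1..M. x0 j)"
      using assms(6) by (simp add: V_def sum_distrib_left)
    finally show ?thesis .
  qed
  have lim: "(\<lambda>k. x k u) \<longlonglongrightarrow> (\<Sum>j = 1..M. x0 j) / real M" if "u \<in> U" for u
    using tendsto_mean_of_diffs[OF finU that all[OF that] total] by (simp add: cardU)
  show ?thesis
    using lim[of "Inl _"] lim[of "Inr _"] unfolding V_def[symmetric] by (auto simp: U_def x_def)
qed

end
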